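(* Let $\mathcal A=(Q,\Sigma,\delta,q_0,F)$ be an arbitrary DFA. Let $\Gamma\subseteq\Sigma$ be such that, for each $a\in\Sigma\setminus\Gamma$, $b\in\Gamma$ and $q\in Q$, we have $\delta(q,ab)=\delta(q,ba)$. Then $\pi_\Gamma(L(\mathcal A))$ is recognizable by a DFA with at most $|Q|$ states.
   Context: A (partial) deterministic finite automaton (DFA) is a quintuple $\mathcal A=(Q,\Sigma,\delta,q_0,F)$ with finite state set $Q$, finite alphabet $\Sigma$, partial transition function $\delta:Q\times\Sigma\to Q$ (extended to words in the usual way), start state $q_0\in Q$ and final states $F\subseteq Q$. An equality such as $\delta(q,ab)=\delta(q,ba)$ means that either both sides are defined and equal, or both are undefined. $\mathcal A$ recognizes $L(\mathcal A)=\{u\in\Sigma^*\mid \delta(q_0,u)\text{ is defined and in }F\}$. For $\Gamma\subseteq\Sigma$, the projection $\pi_\Gamma:\Sigma^*\to\Gamma^*$ is the monoid homomorphism with $\pi_\Gamma(x)=x$ for $x\in\Gamma$ and $\pi_\Gamma(x)=\varepsilon$ for $x\in\Sigma\setminus\Gamma$. The recognizing DFA in the conclusion is over the alphabet $\Gamma$ and may be partial. *)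

theory Defs
  imports Main
begin

record ('q, 'a) dfa =
  states :: "'q set"
  alphabet :: "'a set"
  trans :: "'q \<times> 'a \<rightharpoonup> 'q"
  start :: 'q
  finals :: "'q set"

definition is_dfa :: "('q, 'a) dfa \<Rightarrow> bool" where
  "is_dfa A \<longleftrightarrow>
     finite (states A) \<and> finite (alphabet A) \<and>
     dom (trans A) \<subseteq> states A \<times> alphabet A \<and> ran (trans A) \<subseteq> states A \<and>
     start A \<in> states A \<and> finals A \<subseteq> states A"

text \<open>
  Words are read from left to right, and \<open>None\<close> stands for ``undefined''. Hence an equation
  between values of \<open>run\<close> says that both sides are defined and equal, or both are undefined.
\<close>

fun run :: "('q, 'a) dfa \<Rightarrow> 'q \<Rightarrow> 'a list \<Rightarrow> 'q option" where
  "run A q [] = Some q"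
| "run A q (a # w) = (case trans A (q, a) of None \<Rightarrow> None | Some p \<Rightarrow> run A p w)"

definition lang :: "('q, 'a) dfa \<Rightarrow> 'a list set" where
  "lang A = {u \<in> lists (alphabet A). \<exists>p \<in> finals A. run A (start A) u = Some p}"

definition proj :: "'a set \<Rightarrow> 'a list \<Rightarrow> 'a list" where
  "proj \<Gamma> w = concat (map (\<lambda>x. if x \<in> \<Gamma> then [x] else []) w)"

end

theory Submission
  imports Defs
begin

text \<open>
  The commutation hypothesis lets every word \<open>w\<close> be replaced, without changing its effect on
  states, by its projection \<open>u\<close> to \<open>\<Gamma>\<close> followed by a word \<open>v\<close> over the remaining letters.
  So \<open>u\<close> lies in the projected language iff some such \<open>v\<close> leads from the state reached by \<open>u\<close>
  to a final state; it suffices to restrict the transitions to \<open>\<Gamma>\<close> and to make final all states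
  from which such a \<open>v\<close> exists.
\<close>

lemma proj_eq_filter: "proj \<Gamma> w = filter (\<lambda>x. x \<in> \<Gamma>) w"
  by (induction w) (simp_all add: proj_def)

lemma run_append: "run A q (u @ v) = Option.bind (run A q u) (\<lambda>p. run A p v)"
  by (induction u arbitrary: q) (auto split: option.splits)

lemma trans_in_states:
  assumes "is_dfa A" "trans A (q, a) = Some p"
  shows "p \<in> states A"
  using assms by (auto simp: is_dfa_def ran_def)

lemma run_in_states:
  assumes "is_dfa A" "q \<in> states A" "run A q w = Some p"
  shows "p \<in> states A"
  using assms(2,3)
  by (induction w arbitrary: q) (auto split: option.splits dest: trans_in_states[OF assms(1)])

text \<open>The letter \<open>a\<close> moves to the right past the letters of \<open>u\<close> one
  at a time. Every state met on the way lies in \<open>states A\<close>, so the two-letter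
  hypothesis stays applicable.\<close>

lemma run_letter_commute:
  assumes "is_dfa A"
    and comm: "\<And>b q. b \<in> \<Gamma> \<Longrightarrow> q \<in> states A \<Longrightarrow> run A q [a, b] = run A q [b, a]"
    and "u \<in> lists \<Gamma>" "q \<in> states A"
  shows "run A q (a # u) = run A q (u @ [a])"
  using assms(3,4)
proof (induction u arbitrary: q rule: list.induct)
  case (Cons b u)
  have "run A q [a, b] = run A q [b, a]"
    using Cons.prems by (intro comm) auto
  then have "run A q ([a, b] @ u) = run A q ([b, a] @ u)"
    by (simp only: run_append)
  also have "\<dots> = run A q ([b] @ (a # u))" by simp
  \<comment> \<open>The induction hypothesis is applied at the state reached by \<open>b\<close>; if
    there is none, both sides are \<open>None\<close>.\<close>
  also have "\<dots> = run A q ([b] @ (u @ [a]))"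
    using Cons.IH Cons.prems trans_in_states[OF assms(1)] by (auto split: option.splits)
  finally show ?case by simp
qed simp

text \<open>Letters are treated from the right end of \<open>w\<close>: once the tail is sorted, a
  first letter in \<open>\<Gamma>\<close> is already in place, and any other one moves past the
  \<open>\<Gamma>\<close>-block of the tail, landing in front of the other block.\<close>

lemma run_eq_run_proj_append:
  assumes "is_dfa A"
    and comm: "\<And>a b q. a \<in> alphabet A - \<Gamma> \<Longrightarrow> b \<in> \<Gamma> \<Longrightarrow> q \<in> states A \<Longrightarrow>
           run A q [a, b] = run A q [b, a]"
    and "w \<in> lists (alphabet A)" "q \<in> states A"
  shows "run A q w = run A q (proj \<Gamma> w @ proj (- \<Gamma>) w)"
  using assms(3,4)
proof (induction w arbitrary: q rule: list.induct)
  case Nil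
  then show ?case by (simp add: proj_def)
next
  case (Cons a w)
  let ?u = "proj \<Gamma> w" and ?v = "proj (- \<Gamma>) w"
  have IH: "run A q (a # w) = run A q (a # ?u @ ?v)"
    using Cons.IH Cons.prems trans_in_states[OF assms(1)] by (auto split: option.splits)
  show ?case
  proof (cases "a \<in> \<Gamma>")
    case True
    with IH show ?thesis by (simp add: proj_eq_filter)
  next
    case False
    have "a \<in> alphabet A - \<Gamma>" "?u \<in> lists \<Gamma>"
      using Cons.prems(1) False by (simp_all add: proj_eq_filter in_lists_conv_set)
    then have "run A q (a # ?u) = run A q (?u @ [a])"
      using run_letter_commute[OF assms(1) comm] Cons.prems(2) by blast
    then have "run A q ((a # ?u) @ ?v) = run A q ((?u @ [a]) @ ?v)"
      by (simp only: run_append)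
    with IH False show ?thesis by (simp add: proj_eq_filter)
  qed
qed

lemma run_restrict_alphabet:
  assumes "trans B = trans A |` (UNIV \<times> \<Gamma>)" "u \<in> lists \<Gamma>"
  shows "run B q u = run A q u"
  using assms(2) by (induction u arbitrary: q) (auto simp: assms(1) split: option.splits)

theorem lemma12:
  fixes A :: "('q, 'a) dfa" and \<Gamma> :: "'a set"
  assumes "is_dfa A"
    and "\<Gamma> \<subseteq> alphabet A"
    and "\<And>a b q. a \<in> alphabet A - \<Gamma> \<Longrightarrow> b \<in> \<Gamma> \<Longrightarrow> q \<in> states A \<Longrightarrow>
           run A q [a, b] = run A q [b, a]"
  shows "\<exists>B :: ('q, 'a) dfa. is_dfa B \<and> alphabet B = \<Gamma> \<and>
           lang B = proj \<Gamma> ` lang A \<and> card (states B) \<le> card (states A)"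
proof -
  \<comment> \<open>Only letters outside \<open>\<Gamma>\<close> are allowed in \<open>v\<close>, so
    that projecting \<open>u @ v\<close> gives back \<open>u\<close>.\<close>
  define F where "F = {p \<in> states A. \<exists>v \<in> lists (alphabet A - \<Gamma>). \<exists>f \<in> finals A.
    run A p v = Some f}"
  define B :: "('q, 'a) dfa" where "B = \<lparr>states = states A, alphabet = \<Gamma>,
    trans = trans A |` (UNIV \<times> \<Gamma>), start = start A, finals = F\<rparr>"
  have start: "start A \<in> states A"
    using assms(1) by (simp add: is_dfa_def)
  have "dom (trans B) \<subseteq> states A \<times> \<Gamma>" "ran (trans B) \<subseteq> states A"
    using assms(1) by (force simp: B_def is_dfa_def ran_def restrict_map_def split: if_splits)+
  then have dfa: "is_dfa B"
    using assms(1) finite_subset[OF assms(2)] by (simp add: is_dfa_def B_def F_def)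
  have run_B: "run B q u = run A q u" if "u \<in> lists \<Gamma>" for q u
    using that by (intro run_restrict_alphabet) (simp_all add: B_def)
  have "lang B = proj \<Gamma> ` lang A"
  proof (intro equalityI subsetI)
    fix u assume "u \<in> lang B"
    then have u: "u \<in> lists \<Gamma>" and "\<exists>p \<in> F. run B (start A) u = Some p"
      by (simp_all add: lang_def B_def)
    then obtain p v f where p: "run A (start A) u = Some p"
      and v: "v \<in> lists (alphabet A - \<Gamma>)" and f: "f \<in> finals A" "run A p v = Some f"
      unfolding run_B[OF u] F_def by blast
    have "u @ v \<in> lang A"
      using u p v f assms(2) by (auto simp: lang_def run_append)
    moreover have "proj \<Gamma> (u @ v) = u"
      using u v by (auto simp: proj_eq_filter filter_id_conv filter_empty_conv)
    ultimately show "u \<in> proj \<Gamma> ` lang A" by (metis imageI)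
  next
    fix u assume "u \<in> proj \<Gamma> ` lang A"
    then obtain w f where w: "u = proj \<Gamma> w" "w \<in> lists (alphabet A)"
      and f: "f \<in> finals A" "run A (start A) w = Some f"
      by (auto simp: lang_def)
    \<comment> \<open>Sorting \<open>w\<close> puts \<open>u\<close> in front. The state
      \<open>p\<close> reached after \<open>u\<close> is then final in \<open>B\<close>, with the
      erased letters of \<open>w\<close> as the witness \<open>v\<close>.\<close>
    have "run A (start A) (u @ proj (- \<Gamma>) w) = Some f"
      unfolding w(1) f(2)[symmetric]
      by (rule run_eq_run_proj_append[OF assms(1,3) w(2) start, symmetric])
    then obtain p where p: "run A (start A) u = Some p" "run A p (proj (- \<Gamma>) w) = Some f"
      by (auto simp: run_append bind_eq_Some_conv)
    \<comment> \<open>The complement is taken in the whole letter type; that the letters lie in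
      \<open>alphabet A\<close> comes from \<open>w\<close>.\<close>
    have "proj (- \<Gamma>) w \<in> lists (alphabet A - \<Gamma>)"
      using w(2) by (auto simp: proj_eq_filter)
    then have "p \<in> F"
      using p f(1) run_in_states[OF assms(1) start] unfolding F_def by blast
    moreover have u: "u \<in> lists \<Gamma>"
      using w(1) by (auto simp: proj_eq_filter)
    ultimately show "u \<in> lang B"
      using p(1) run_B[OF u, of "start A"] by (auto simp: lang_def B_def)
  qed
  with dfa show ?thesis by (intro exI[of _ B]) (simp add: B_def)
qed

end
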